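(* Let $m\ge2$, $\Sigma=\{0,1,\ldots,m-1\}$, and let $T=(v,\Sigma,P)$ be a tag system. Let $L_T$ be the rational Lagrange interpolation polynomial determined by $L_T(a)=c_m(P(a))$ for $0\le a<m$. Define $$D_m(s):=s-mJ\!\left(\frac{s}{m}\right),\qquad N_m(s):=J\!\left(\log_m s\right),$$ $$F_{T,m}(s):=J\!\left(\frac{s}{m^v}\right)+m^{N_m(s)-v}\bigl(L_T(D_m(s))-1\bigr).$$ Then for every word $w\in\Sigma^*$ with $\operatorname{len}(w)\ge v$, $$F_{T,m}(c_m(w))=c_m(\operatorname{step}_T(w)).$$
   Context: Principal values: for $z\in\mathbb{C}\setminus\{0\}$, $\operatorname{Log} z=\log|z|+i\operatorname{Arg} z$ with $\operatorname{Arg} z\in(-\pi,\pi]$. For $x\neq 0$, $x^y:=e^{y\operatorname{Log}x}$; for $a,b\ne0$, $b\neq1$, $\log_b a:=\operatorname{Log}a/\operatorname{Log}b$. For real $u$, $J(u):=u-\frac12+\frac{\operatorname{Log}(e^{2\pi i(1/2-u)})}{2\pi i}$. A tag system $T=(v,\Sigma,P)$ consists of an integer deletion number $v\ge2$, a finite alphabet $\Sigma$, and a production map $P:\Sigma\to\Sigma^*$. From a word $w=w_1\cdots w_n$ with $n\ge v$, one step deletes $w_1\cdots w_v$ and appends $P(w_1)$; that is, $\operatorname{step}_T(w)=w_{v+1}\cdots w_n P(w_1)$. The system halts when $n<v$. $\operatorname{len}(w)$ is the length of $w$. Encoding: for $w=w_1\cdots w_n\in\Sigma^*$ with $\Sigma=\{0,\ldots,m-1\}$,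 $c_m(w):=m^n+\sum_{r=1}^n w_r m^{r-1}$ (so $c_m(\varepsilon)=1$ for the empty word $\varepsilon$). The Lagrange interpolation polynomial is the unique polynomial of degree less than $m$ with rational coefficients taking the prescribed values at $0,1,\ldots,m-1$. *)

theory Defs
  imports
    "HOL-Analysis.Analysis"
    "HOL-Computational_Algebra.Polynomial"
begin

text \<open>
  On the complex numbers, \<^const>\<open>ln\<close> is the principal branch (imaginary part in the
  half-open interval from \<open>-pi\<close>, excluded, to \<open>pi\<close>, included), and \<open>x powr y\<close> is
  \<open>exp (y * ln x)\<close> for nonzero \<open>x\<close>.
  The library's \<^const>\<open>log\<close> is restricted to real arguments.
\<close>

definition clog :: "complex \<Rightarrow> complex \<Rightarrow> complex"
  where "clog b a = ln a / ln b"

text \<open>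
  \<open>J\<close> is meant for real \<open>u\<close>. The same formula is read on all complex numbers, so
  that it applies to complex-valued expressions such as \<open>clog m s\<close> without a projection to the
  reals.
\<close>

definition J :: "complex \<Rightarrow> complex"
  where "J u = u - 1/2 + ln (exp (2 * pi * \<i> * (1/2 - u))) / (2 * pi * \<i>)"

record 'a tag_system =
  deletion :: nat
  alphabet :: "'a set"
  production :: "'a \<Rightarrow> 'a list"

definition is_tag_system :: "'a tag_system \<Rightarrow> bool"
  where "is_tag_system T \<longleftrightarrow>
    deletion T \<ge> 2 \<and> finite (alphabet T) \<and>
    (\<forall>a \<in> alphabet T. production T a \<in> lists (alphabet T))"

text \<open>
  A step of the system exists only for words of length at least \<open>deletion T\<close>; on shorter
  words the system halts and the value below is irrelevant.
\<close>

definition tag_step :: "'a tag_system \<Rightarrow> 'a list \<Rightarrow> 'a list"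
  where "tag_step T w = drop (deletion T) w @ production T (hd w)"

text \<open>Words are indexed from 1 in the formula, hence the shift in \<open>w ! (r - 1)\<close>.\<close>

definition encode :: "nat \<Rightarrow> nat list \<Rightarrow> nat"
  where "encode m w = m ^ length w + (\<Sum>r = 1..length w. w ! (r - 1) * m ^ (r - 1))"

definition lagrange_poly :: "nat \<Rightarrow> (nat \<Rightarrow> rat) \<Rightarrow> rat poly"
  where "lagrange_poly m y =
    (THE p. degree p < m \<and> (\<forall>a<m. poly p (of_nat a) = y a))"

lemma lagrange_poly_ex1:
  assumes "m > 0"
  shows "\<exists>!p :: rat poly. degree p < m \<and> (\<forall>a<m. poly p (of_nat a) = y a)"
proof (rule ex_ex1I)
  define B :: "nat \<Rightarrow> rat poly" where "B a = (\<Prod>b\<in>{..<m}-{a}. [:- of_nat b, 1:])" for a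
  define p where "p = (\<Sum>a<m. smult (y a / poly (B a) (of_nat a)) (B a))"
  have degB: "degree (B a) \<le> m - 1" if "a < m" for a
  proof -
    have "degree (B a) \<le> (\<Sum>b\<in>{..<m}-{a}. degree [:- of_nat b, 1 :: rat:])"
      unfolding B_def by (rule order_trans[OF degree_prod_sum_le]) (auto simp: o_def)
    also have "\<dots> = m - 1" using that by simp
    finally show ?thesis .
  qed
  have "degree p \<le> m - 1" unfolding p_def
    using degB by (intro degree_sum_le) (auto intro: order_trans[OF degree_smult_le])
  hence "degree p < m" using assms by simp
  moreover have "poly p (of_nat c) = y c" if "c < m" for c
  proof -
    have nz: "poly (B c) (of_nat c) \<noteq> 0"
      by (auto simp: B_def poly_prod)
    have z: "poly (B a) (of_nat c) = 0" if "a \<noteq> c" for a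
      using that \<open>c < m\<close> by (auto simp: B_def poly_prod)
    have "poly p (of_nat c) = (\<Sum>a<m. if a = c then y c else 0)"
      unfolding p_def poly_sum by (rule sum.cong) (auto simp: nz z)
    thus ?thesis using that by simp
  qed
  ultimately show "\<exists>p :: rat poly. degree p < m \<and> (\<forall>a<m. poly p (of_nat a) = y a)"
    by blast
next
  fix p q :: "rat poly"
  assume p: "degree p < m \<and> (\<forall>a<m. poly p (of_nat a) = y a)"
    and q: "degree q < m \<and> (\<forall>a<m. poly q (of_nat a) = y a)"
  have "card (of_nat ` {..<m} :: rat set) = m"
    by (subst card_image) (auto simp: inj_on_def)
  thus "p = q" using p q
    by (intro poly_eqI_degree[of "of_nat ` {..<m}"]) auto
qed

definition L_poly :: "nat tag_system \<Rightarrow> nat \<Rightarrow> rat poly"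
  where "L_poly T m = lagrange_poly m (\<lambda>a. of_nat (encode m (production T a)))"

definition D_fun :: "nat \<Rightarrow> complex \<Rightarrow> complex"
  where "D_fun m s = s - of_nat m * J (s / of_nat m)"

definition N_fun :: "nat \<Rightarrow> complex \<Rightarrow> complex"
  where "N_fun m s = J (clog (of_nat m) s)"

definition F_fun :: "nat tag_system \<Rightarrow> nat \<Rightarrow> complex \<Rightarrow> complex"
  where "F_fun T m s =
    J (s / of_nat m ^ deletion T) +
    of_nat m powr (N_fun m s - of_nat (deletion T)) *
      (poly (map_poly of_rat (L_poly T m)) (D_fun m s) - 1)"

end

theory Submission
  imports Defs
begin

text \<open>
  On the real axis \<open>J\<close> is the floor function, and \<open>encode m w\<close> is the number whose
  base-\<open>m\<close> digits, least significant first, are the letters of \<open>w\<close> followed by a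
  leading digit 1. The four ingredients of \<open>F_fun\<close> therefore do ordinary digit arithmetic on
  \<open>s = encode m w\<close>: \<open>J (s / m ^ v)\<close> drops the first \<open>v\<close> letters,
  \<open>D_fun m s = s mod m\<close> reads the first letter \<open>a\<close>, and
  \<open>N_fun m s\<close>, the floor of the base-\<open>m\<close> logarithm, is the position of the leading digit,
  which is the length of \<open>w\<close>. The interpolation polynomial turns \<open>a\<close> into the code of
  its production.

  Appending a word \<open>p\<close> to the remaining word \<open>u\<close> puts the digits of
  \<open>encode m p\<close>, its leading 1 included, at the position of the leading 1 of \<open>u\<close>, so
  the code grows by \<open>m ^ length u * (encode m p - 1)\<close> (lemma \<open>encode_append\<close>). This is the
  second summand of \<open>F_fun\<close>, since \<open>length u = length w - v\<close>.
\<close>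

text \<open>
  The exponential in \<open>J\<close> does not change when \<open>u\<close> is replaced by
  \<open>t = u - \<lfloor>u\<rfloor>\<close> in \<open>[0, 1)\<close>, and \<open>2 * pi * \<i> * (1/2 - t)\<close> has its
  imaginary part in \<open>(-pi, pi]\<close>, so the principal logarithm recovers it exactly. The shift by
  \<open>1/2\<close> is what matches the closed end of this interval to \<open>t = 0\<close>, and thus gives
  the right value at the integers.
\<close>

lemma J_of_real: "J (of_real u) = of_int \<lfloor>u\<rfloor>"
proof -
  define t where "t = frac u"
  have t: "0 \<le> t" "t < 1"
    by (simp_all add: t_def frac_ge_0 frac_lt_1)
  have u: "u = of_int \<lfloor>u\<rfloor> + t"
    by (simp add: t_def frac_def)
  define z where "z = 2 * of_real pi * \<i> * (1/2 - complex_of_real t)"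
  have Im_z: "Im z = pi - 2 * pi * t"
    by (simp add: z_def algebra_simps)
  have "pi * t < pi * 1"
    using t by (intro mult_strict_left_mono) auto
  hence "-pi < Im z" "Im z \<le> pi"
    using t by (simp_all add: Im_z)
  hence Ln_z: "ln (exp z) = z"
    by (intro Ln_exp)
  have "2 * of_real pi * \<i> * (1/2 - complex_of_real u)
      = z + of_int (2 * (- \<lfloor>u\<rfloor>)) * of_real pi * \<i>"
    by (subst u) (simp add: z_def algebra_simps)
  hence "exp (2 * of_real pi * \<i> * (1/2 - complex_of_real u)) = exp z"
    unfolding exp_eq by (intro exI[of _ "- \<lfloor>u\<rfloor>"]) simp
  hence "J (of_real u) = complex_of_real u - 1/2 + z / (2 * of_real pi * \<i>)"
    by (simp add: J_def Ln_z)
  also have "\<dots> = complex_of_real (u - t)"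
    by (simp add: z_def)
  also have "u - t = of_int \<lfloor>u\<rfloor>"
    using u by simp
  finally show ?thesis
    by simp
qed

lemma J_of_nat_divide: "J (of_nat a / of_nat b) = of_nat (a div b)"
  using J_of_real[of "real a / real b"] by (simp add: floor_divide_of_nat_eq)

lemma D_fun_of_nat: "D_fun m (of_nat s) = of_nat (s mod m)"
proof -
  have "complex_of_nat s = of_nat (s mod m + m * (s div m))"
    by simp
  also have "\<dots> = of_nat (s mod m) + of_nat m * of_nat (s div m)"
    by (simp only: of_nat_add of_nat_mult)
  finally have "complex_of_nat s - of_nat m * of_nat (s div m) = of_nat (s mod m)"
    by (simp only: add_diff_cancel_right')
  thus ?thesis
    by (simp only: D_fun_def J_of_nat_divide)
qed

lemma N_fun_of_nat:
  assumes "m \<ge> 2" "m ^ n \<le> s" "s < m ^ Suc n"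
  shows "N_fun m (of_nat s) = of_nat n"
proof -
  have "0 < m ^ n"
    using assms(1) by simp
  hence s: "s > 0"
    using assms(2) by linarith
  have ln_nat: "ln (complex_of_nat k) = of_real (ln (real k))" if "k > 0" for k
    using Ln_of_real[of "real k"] that by simp
  have "clog (of_nat m) (of_nat s) = of_real (log (real m) (real s))"
    using assms(1) s by (simp add: clog_def ln_nat log_def)
  moreover have "\<lfloor>log (real m) (real s)\<rfloor> = int n"
    using assms s by (subst floor_log_nat_eq_powr_iff) auto
  ultimately show ?thesis
    by (simp add: N_fun_def J_of_real)
qed

lemma encode_Nil: "encode m [] = 1"
  by (simp add: encode_def)

text \<open>
  Horner's scheme: the code of a word has the first letter as its least significant digit and the
  code of the remaining word above it. Reading or deleting the first letter thus becomes taking a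
  remainder or a quotient modulo \<open>m\<close>.
\<close>

lemma encode_Cons: "encode m (a # w) = a + m * encode m w"
proof -
  have digits: "(\<Sum>r = 1..length u. u ! (r - 1) * m ^ (r - 1)) = (\<Sum>i<length u. u ! i * m ^ i)" for u
    by (rule sum.reindex_bij_witness[of _ Suc "\<lambda>r. r - 1"]) auto
  show ?thesis
    unfolding encode_def digits
    by (simp add: sum.lessThan_Suc_shift sum_distrib_left algebra_simps del: sum.lessThan_Suc)
qed

text \<open>
  Writing \<open>m ^ length u\<close> on the left avoids subtraction: it is the leading 1 of \<open>u\<close>,
  which concatenation replaces by the code of \<open>w\<close>.
\<close>

lemma encode_append:
  "encode m (u @ w) + m ^ length u = encode m u + m ^ length u * encode m w"
  by (induction u) (auto simp: encode_Nil encode_Cons algebra_simps simp flip: distrib_left)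

lemma encode_ge: "m ^ length w \<le> encode m w"
  by (simp add: encode_def)

lemma encode_less:
  assumes "m \<ge> 2" "set w \<subseteq> {0..<m}"
  shows "encode m w < m ^ Suc (length w)"
  using assms(2)
proof (induction w)
  case Nil
  then show ?case using assms(1) by (simp add: encode_Nil)
next
  case (Cons a w)
  then have "Suc (encode m w) \<le> m ^ Suc (length w)" "a < m"
    by auto
  have "encode m (a # w) < m * Suc (encode m w)"
    using \<open>a < m\<close> by (simp add: encode_Cons)
  also have "\<dots> \<le> m * m ^ Suc (length w)"
    by (rule mult_le_mono2) fact
  finally show ?case by simp
qed

lemma encode_div_power:
  assumes "set w \<subseteq> {0..<m}" "k \<le> length w"
  shows "encode m w div m ^ k = encode m (drop k w)"
  using assms
proof (induction k arbitrary: w)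
  case (Suc k)
  then obtain a u where w: "w = a # u"
    by (cases w) auto
  have "a < m"
    using Suc.prems w by auto
  hence "encode m w div m = encode m u"
    by (simp add: w encode_Cons)
  thus ?case
    using Suc.prems Suc.IH[of u] by (simp add: w div_mult2_eq)
qed simp

lemma encode_mod:
  assumes "set w \<subseteq> {0..<m}" "w \<noteq> []"
  shows "encode m w mod m = hd w"
  using assms by (cases w) (auto simp: encode_Cons)

lemma poly_map_poly_of_rat:
  "poly (map_poly of_rat p) (of_rat x :: 'a :: field_char_0) = of_rat (poly p x)"
  by (induction p) (auto simp: map_poly_pCons of_rat_add of_rat_mult)

lemma poly_L_poly:
  assumes "a < m"
  shows "poly (L_poly T m) (of_nat a) = of_nat (encode m (production T a))"
proof -
  let ?y = "\<lambda>a. of_nat (encode m (production T a)) :: rat"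
  have "m > 0"
    using assms by simp
  from theI'[OF lagrange_poly_ex1[OF this, of ?y]] show ?thesis
    using assms by (simp add: L_poly_def lagrange_poly_def)
qed

theorem proposition4p3:
  fixes m :: nat and T :: "nat tag_system" and w :: "nat list"
  assumes "m \<ge> 2"
    and "is_tag_system T"
    and "alphabet T = {0..<m}"
    and "w \<in> lists (alphabet T)"
    and "length w \<ge> deletion T"
  shows "F_fun T m (of_nat (encode m w)) = of_nat (encode m (tag_step T w))"
proof -
  let ?v = "deletion T" and ?s = "encode m w"
  define u where "u = drop ?v w"
  define p where "p = production T (hd w)"
  have v: "?v \<ge> 2"
    using assms(2) by (simp add: is_tag_system_def)
  have w: "set w \<subseteq> {0..<m}" "w \<noteq> []"
    using assms v by auto
  have hd_w: "hd w < m"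
    using w by (cases w) auto
  have quotient: "J (of_nat ?s / of_nat m ^ ?v) = of_nat (encode m u)"
    using J_of_nat_divide[of ?s "m ^ ?v"] encode_div_power[OF w(1) assms(5)]
    by (simp add: u_def)
  have "N_fun m (of_nat ?s) - of_nat ?v = of_nat (length u)"
    using N_fun_of_nat[OF assms(1) encode_ge encode_less[OF assms(1) w(1)]] assms(5)
    by (simp add: u_def of_nat_diff)
  hence scale: "of_nat m powr (N_fun m (of_nat ?s) - of_nat ?v) = (of_nat m ^ length u :: complex)"
    using assms(1) by (simp add: powr_nat')
  have "D_fun m (of_nat ?s) = of_rat (of_nat (hd w))"
    using encode_mod[OF w] by (simp add: D_fun_of_nat)
  hence letter_code: "poly (map_poly of_rat (L_poly T m)) (D_fun m (of_nat ?s)) = of_nat (encode m p)"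
    by (metis poly_map_poly_of_rat poly_L_poly[OF hd_w] of_rat_of_nat_eq p_def)
  have "F_fun T m (of_nat ?s) = of_nat (encode m u) + of_nat m ^ length u * (of_nat (encode m p) - 1)"
    by (simp add: F_fun_def quotient scale letter_code)
  also have "\<dots> = of_nat (encode m u + m ^ length u * encode m p) - of_nat (m ^ length u)"
    by (simp add: algebra_simps)
  also have "\<dots> = of_nat (encode m (u @ p))"
    by (simp flip: encode_append)
  finally show ?thesis
    by (simp add: tag_step_def u_def p_def)
qed

end
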